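(* For all integers $r,\ell\ge 2$ there exists a tree $T$ with exactly $\ell$ leaves and \[ \mathcal{D}_r(T,\mathcal{T})=\left\lceil (r-1)\cdot\frac{\ell}{2}\right\rceil . \]
   Context: All graphs are finite. A leaf of a tree is a vertex of degree $1$. Write $[r]=\{1,\dots,r\}$. $\mathcal{T}$ denotes the set of all trees. For a tree $T$ and an integer $r\ge 2$, the $r$-colour discrepancy of trees in $T$ is \[ \mathcal{D}_r(T,\mathcal{T})=\min_{f:E(T)\to[r]}\ \max_{S}\ \max_{j\in[r]}\left(r\left|f^{-1}(j)\cap E(S)\right|-|E(S)|\right), \] where the first maximum is over all subtrees $S$ of $T$. *)

theory Defs
  imports Complex_Main "HOL-Library.FuncSet"
begin

type_synonym 'a graph = "'a set \<times> 'a set set"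

abbreviation verts :: "'a graph \<Rightarrow> 'a set" where
  "verts G \<equiv> fst G"

abbreviation edges :: "'a graph \<Rightarrow> 'a set set" where
  "edges G \<equiv> snd G"

definition simple_graph :: "'a graph \<Rightarrow> bool" where
  "simple_graph G \<longleftrightarrow>
     finite (verts G) \<and>
     (\<forall>e\<in>edges G. \<exists>u v. u \<in> verts G \<and> v \<in> verts G \<and> u \<noteq> v \<and> e = {u, v})"

definition adj :: "'a graph \<Rightarrow> 'a \<Rightarrow> 'a \<Rightarrow> bool" where
  "adj G u v \<longleftrightarrow> {u, v} \<in> edges G"

definition graph_connected :: "'a graph \<Rightarrow> bool" where
  "graph_connected G \<longleftrightarrow>
     verts G \<noteq> {} \<and> (\<forall>u\<in>verts G. \<forall>v\<in>verts G. (adj G)\<^sup>*\<^sup>* u v)"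

text \<open>A cycle is given by the list of its vertices, without repeating the first one at the end.\<close>

definition is_cycle :: "'a graph \<Rightarrow> 'a list \<Rightarrow> bool" where
  "is_cycle G xs \<longleftrightarrow>
     3 \<le> length xs \<and> distinct xs \<and> successively (adj G) xs \<and> adj G (last xs) (hd xs)"

definition is_tree :: "'a graph \<Rightarrow> bool" where
  "is_tree G \<longleftrightarrow> simple_graph G \<and> graph_connected G \<and> (\<nexists>xs. is_cycle G xs)"

definition degree :: "'a graph \<Rightarrow> 'a \<Rightarrow> nat" where
  "degree G v = card {e \<in> edges G. v \<in> e}"

definition leaves :: "'a graph \<Rightarrow> 'a set" where
  "leaves G = {v \<in> verts G. degree G v = 1}"

definition subtrees :: "'a graph \<Rightarrow> 'a graph set" where
  "subtrees G = {S. verts S \<subseteq> verts G \<and> edges S \<subseteq> edges G \<and> is_tree S}"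

definition tree_discrepancy :: "nat \<Rightarrow> 'a graph \<Rightarrow> int" where
  "tree_discrepancy r T =
     (MIN f\<in>edges T \<rightarrow>\<^sub>E {1..r}. MAX S\<in>subtrees T. MAX j\<in>{1..r}.
        int r * int (card (f -` {j} \<inter> edges S)) - int (card (edges S)))"

text \<open>
  The following facts show that the minimum and the maxima above range over finite nonempty
  sets whenever the graph is a tree and there is at least one colour.
\<close>

lemma finite_edges: "simple_graph G \<Longrightarrow> finite (edges G)"
  by (rule finite_subset[of _ "Pow (verts G)"]) (auto simp: simple_graph_def)

lemma finite_subtrees: "simple_graph G \<Longrightarrow> finite (subtrees G)"
  by (rule finite_subset[of _ "Pow (verts G) \<times> Pow (edges G)"])
    (auto simp: subtrees_def simple_graph_def finite_edges)

lemma subtrees_nonempty: "is_tree T \<Longrightarrow> subtrees T \<noteq> {}"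
  unfolding subtrees_def by blast

lemma finite_colourings: "simple_graph G \<Longrightarrow> finite (edges G \<rightarrow>\<^sub>E {1..r::nat})"
  by (simp add: finite_PiE finite_edges)

lemma colourings_nonempty: "1 \<le> r \<Longrightarrow> (edges G \<rightarrow>\<^sub>E {1..r::nat}) \<noteq> {}"
  by (simp add: PiE_eq_empty_iff)

end

theory Submission
  imports Defs
begin

text \<open>
  The tree is the spider with \<open>l\<close> legs of length \<open>r - 1\<close> attached to a centre.  For a colour \<open>j\<close>,
  give an edge the weight \<open>r - 1\<close> if it has colour \<open>j\<close> and \<open>- 1\<close> otherwise; the discrepancy of a
  subtree in colour \<open>j\<close> is its total weight.  A subtree through the centre is an independent
  choice of an initial segment of every leg, so the largest weight of such a subtree is the sum
  over the legs of \<open>M\<^sub>i j\<close>, the maximal weight of an initial segment of leg \<open>i\<close>.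

  Lower bound (\<open>leg_lower_bound\<close>, \<open>spider_lower_bound\<close>).  Fix a leg.  The weight for colour \<open>j\<close> of
  its initial segment with \<open>t\<close> edges is congruent to \<open>- t\<close> modulo \<open>r\<close>, so the segments with
  \<open>0, \<dots>, r - 1\<close> edges give \<open>r\<close> distinct integers, all at most \<open>M\<^sub>i j\<close>; hence their sum is at most
  \<open>r * M\<^sub>i j - r * (r - 1) / 2\<close>.  For fixed \<open>t\<close> the weights of the \<open>r\<close> colours cancel.  Summing over
  all colours therefore shows that the \<open>M\<^sub>i j\<close> of one leg add up to at least \<open>r * (r - 1) / 2\<close>,
  and averaging the sum over all legs gives a colour in which some subtree has weight at least
  \<open>l * (r - 1) / 2\<close>.  The discrepancy is an integer, which accounts for the rounding.

  Upper bound (\<open>balanced_rankings\<close>, \<open>spider_upper_bound\<close>).  Let \<open>s\<^sub>i\<close> be a bijection from the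
  colours to \<open>0, \<dots>, r - 1\<close>.  If leg \<open>i\<close> carries, from the centre outwards, the colours with
  \<open>s\<^sub>i\<close>-values \<open>r - 1, r - 2, \<dots>, 1\<close>, then \<open>M\<^sub>i j = s\<^sub>i j\<close>.  So it suffices to find \<open>l\<close> such bijections whose sum is as
  constant as parity permits.  A ranking and its reverse have constant sum \<open>r - 1\<close>, which settles
  even \<open>l\<close>; for odd \<open>l\<close> one starts from three explicit rankings.  A subtree that avoids the centre
  lies in one leg and has at most one edge of each colour, so its discrepancy is at most
  \<open>r - 1\<close>, which does not exceed the target because \<open>l\<close> is at least 2.
\<close>

section \<open>Graphs given by a parent function\<close>

definition parent_graph :: "(nat \<Rightarrow> nat) \<Rightarrow> nat set \<Rightarrow> nat graph" where
  "parent_graph p V = (V, (\<lambda>v. {v, p v}) ` (V - {0}))"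

lemma adj_sym: "adj G u v \<Longrightarrow> adj G v u"
  by (simp add: adj_def insert_commute)

lemma adj_parent_graph:
  "adj (parent_graph p V) x y \<longleftrightarrow> (x \<in> V - {0} \<and> y = p x) \<or> (y \<in> V - {0} \<and> x = p y)"
  by (auto simp: adj_def parent_graph_def doubleton_eq_iff)

lemma cycle_two_neighbours:
  assumes "is_cycle G xs" "x \<in> set xs"
  obtains y z where "y \<in> set xs" "z \<in> set xs" "y \<noteq> z" "adj G x y" "adj G x z"
proof -
  let ?L = "length xs"
  from assms have L: "3 \<le> ?L" and d: "distinct xs" and s: "successively (adj G) xs"
    and lh: "adj G (last xs) (hd xs)"
    by (auto simp: is_cycle_def)
  have step: "adj G (xs ! i) (xs ! (Suc i mod ?L))" if "i < ?L" for i
  proof (cases "Suc i < ?L")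
    case True
    with s show ?thesis by (simp add: successively_conv_nth)
  next
    case False
    with that have "i = ?L - 1" by simp
    moreover have "xs \<noteq> []" using L by auto
    ultimately show ?thesis using lh L by (simp add: last_conv_nth hd_conv_nth)
  qed
  obtain i where i: "i < ?L" "x = xs ! i" using assms(2) by (metis in_set_conv_nth)
  define a where "a = Suc i mod ?L"
  define b where "b = (if i = 0 then ?L - 1 else i - 1)"
  have a: "a < ?L" "a \<noteq> i" and ab: "a \<noteq> b" and b: "b < ?L" "b \<noteq> i" "Suc b mod ?L = i"
    using L i by (auto simp: a_def b_def mod_Suc split: if_splits)
  show thesis
  proof (rule that)
    show "adj G x (xs ! a)" using step[OF i(1)] i a_def by simp
    show "adj G x (xs ! b)" using adj_sym[OF step[OF b(1)]] i b by simp
  qed (use a b ab i d in \<open>auto simp: nth_eq_iff_index_eq\<close>)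
qed

text \<open>
  Every vertex descends to \<open>0\<close>, so the graph is connected; and the largest vertex of a cycle
  would have two smaller neighbours, whereas its only smaller neighbour is its parent.
\<close>

lemma is_tree_parent_graph:
  assumes "finite V" "0 \<in> V" "\<And>v. v \<in> V \<Longrightarrow> v \<noteq> 0 \<Longrightarrow> p v \<in> V \<and> p v < v"
  shows "is_tree (parent_graph p V)"
proof -
  let ?G = "parent_graph p V"
  have "simple_graph ?G"
    unfolding simple_graph_def parent_graph_def using assms by fastforce
  moreover have "graph_connected ?G"
  proof -
    have to0: "v \<in> V \<Longrightarrow> (adj ?G)\<^sup>*\<^sup>* v 0" for v
    proof (induction v rule: less_induct)
      case (less v)
      show ?case
      proof (cases "v = 0")
        case False
        then have "adj ?G v (p v)" using less by (auto simp: adj_parent_graph)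
        with less assms(3)[of v] False show ?thesis by (meson converse_rtranclp_into_rtranclp)
      qed simp
    qed
    have sym: "symp (adj ?G)\<^sup>*\<^sup>*" by (rule symp_rtranclp) (blast intro: sympI adj_sym)
    have "(adj ?G)\<^sup>*\<^sup>* u v" if "u \<in> V" "v \<in> V" for u v
      using to0[OF that(1)] sympD[OF sym to0[OF that(2)]] by (rule rtranclp_trans)
    with assms(2) show ?thesis by (auto simp: graph_connected_def parent_graph_def)
  qed
  moreover have "\<not> is_cycle ?G xs" for xs
  proof
    assume c: "is_cycle ?G xs"
    then have "set xs \<noteq> {}" by (auto simp: is_cycle_def)
    then have "Max (set xs) \<in> set xs" by simp
    from cycle_two_neighbours[OF c this] obtain y z where
      yz: "y \<in> set xs" "z \<in> set xs" "y \<noteq> z" "adj ?G (Max (set xs)) y" "adj ?G (Max (set xs)) z"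
      by metis
    have "w = p (Max (set xs))" if "w \<in> set xs" "adj ?G (Max (set xs)) w" for w
    proof -
      have "w \<le> Max (set xs)" using that by simp
      with that assms(3) show ?thesis by (fastforce simp: adj_parent_graph)
    qed
    with yz show False by metis
  qed
  ultimately show ?thesis by (auto simp: is_tree_def)
qed

lemma connected_invariant:
  assumes "graph_connected G" "u \<in> verts G" "w \<in> verts G" "P u"
    and step: "\<And>x y. adj G x y \<Longrightarrow> P x \<Longrightarrow> P y"
  shows "P w"
proof -
  have "(adj G)\<^sup>*\<^sup>* u w" using assms by (auto simp: graph_connected_def)
  then show ?thesis by (induction rule: rtranclp_induct) (use assms in auto)
qed

section \<open>Spiders\<close>

text \<open>
  The legs are interleaved: each step away from the centre \<open>0\<close> adds \<open>l\<close>, except that the first step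
  onto a leg leads to one of \<open>1, \<dots>, l\<close>.  Truncated subtraction makes \<open>0\<close> the parent of these.
\<close>

definition spider :: "nat \<Rightarrow> nat \<Rightarrow> nat graph" where
  "spider l n = parent_graph (\<lambda>v. v - l) {0..l * n}"

lemma verts_spider [simp]: "verts (spider l n) = {0..l * n}"
  by (simp add: spider_def parent_graph_def)

lemma edges_spider: "edges (spider l n) = (\<lambda>v. {v, v - l}) ` {1..l * n}"
proof -
  have "{0..l * n} - {0} = {1..l * n}" by auto
  then show ?thesis by (simp add: spider_def parent_graph_def)
qed

lemma is_tree_spider: "1 \<le> l \<Longrightarrow> is_tree (spider l n)"
  unfolding spider_def by (rule is_tree_parent_graph) auto

lemma inj_on_spider_edge:
  fixes l :: nat shows "1 \<le> l \<Longrightarrow> inj_on (\<lambda>v. {v, v - l}) {1..}"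
  by (auto simp: inj_on_def doubleton_eq_iff)

lemma card_leaves_spider:
  assumes "2 \<le> l" "1 \<le> n"
  shows "card (leaves (spider l n)) = l"
proof -
  let ?e = "\<lambda>v. {v, v - l}"
  have deg: "degree (spider l n) v = card {w \<in> {1..l * n}. v \<in> ?e w}" for v
  proof -
    have "{e \<in> edges (spider l n). v \<in> e} = ?e ` {w \<in> {1..l * n}. v \<in> ?e w}"
      by (auto simp: edges_spider)
    moreover have "inj_on ?e {w \<in> {1..l * n}. v \<in> ?e w}"
      by (rule inj_on_subset[OF inj_on_spider_edge]) (use assms in auto)
    ultimately show ?thesis by (simp add: degree_def card_image)
  qed
  have ln: "l \<le> l * n" using assms by simp
  have "{w \<in> {1..l * n}. 0 \<in> ?e w} = {1..l}"
    by (auto intro: le_trans[OF _ ln])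
  then have d0: "degree (spider l n) 0 = l" using deg by simp
  have d: "degree (spider l n) v = (if v + l \<le> l * n then 2 else 1)"
    if "1 \<le> v" "v \<le> l * n" for v
  proof -
    have "v \<in> ?e w \<longleftrightarrow> w = v \<or> w = v + l" for w
      using \<open>1 \<le> v\<close> by auto
    then have "{w \<in> {1..l * n}. v \<in> ?e w} = {w \<in> {v, v + l}. 1 \<le> w \<and> w \<le> l * n}"
      by (simp only: atLeastAtMost_iff insert_iff empty_iff) blast
    also have "\<dots> = (if v + l \<le> l * n then {v, v + l} else {v})" using that by auto
    finally show ?thesis using assms by (simp add: deg)
  qed
  have "leaves (spider l n) = {l * n - l<..l * n}"
  proof (intro equalityI subsetI)
    fix v assume "v \<in> leaves (spider l n)"
    then have v: "v \<le> l * n" "degree (spider l n) v = 1" by (simp_all add: leaves_def)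
    then have "v \<noteq> 0" using d0 assms(1) by (intro notI) simp
    with v d[of v] have "\<not> v + l \<le> l * n" by (intro notI) simp
    with v(1) show "v \<in> {l * n - l<..l * n}"
      unfolding greaterThanAtMost_iff less_diff_conv2[OF ln] by (simp only: not_le simp_thms)
  next
    fix v assume "v \<in> {l * n - l<..l * n}"
    then have "l * n - l < v" "v \<le> l * n" by simp_all
    with ln have v: "1 \<le> v" "v \<le> l * n" "\<not> v + l \<le> l * n" by linarith+
    with d[OF v(1,2)] show "v \<in> leaves (spider l n)" by (simp add: leaves_def)
  qed
  then show ?thesis using ln by simp
qed

lemma leg_vertex_in_range:
  fixes i k l n :: nat
  assumes "i < l" "k < n"
  shows "k * l + i + 1 \<in> {1..l * n}"
proof -
  have "Suc k * l \<le> n * l" using assms(2) by (intro mult_le_mono1) simp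
  with assms(1) show ?thesis by (simp add: mult.commute)
qed

text \<open>
  The vertex at distance \<open>k + 1\<close> from the centre on leg \<open>i\<close> is \<open>k * l + i + 1\<close>; division with
  remainder by \<open>l\<close> recovers \<open>k\<close> and \<open>i\<close>.
\<close>

lemma card_by_legs:
  fixes l n :: nat
  assumes "W \<subseteq> {1..l * n}"
  shows "card W = (\<Sum>i<l. card {k. k < n \<and> k * l + i + 1 \<in> W})"
proof -
  let ?A = "\<lambda>i. {k. k < n \<and> k * l + i + 1 \<in> W}"
  have "bij_betw (\<lambda>(i, k). k * l + i + 1) (SIGMA i:{..<l}. ?A i) W"
  proof (rule bij_betwI[where g = "\<lambda>v. ((v - 1) mod l, (v - 1) div l)"])
    show "(\<lambda>v. ((v - 1) mod l, (v - 1) div l)) \<in> W \<rightarrow> (SIGMA i:{..<l}. ?A i)"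
    proof
      fix v assume v: "v \<in> W"
      with assms have "1 \<le> v" "v \<le> l * n" by auto
      then have "0 < l" "v - 1 < n * l" by (auto intro!: Nat.gr0I simp: mult.commute)
      with v \<open>1 \<le> v\<close> show "((v - 1) mod l, (v - 1) div l) \<in> (SIGMA i:{..<l}. ?A i)"
        by (simp add: less_mult_imp_div_less)
    qed
  qed (use assms in \<open>auto simp: subset_iff\<close>)
  then have "card W = card (SIGMA i:{..<l}. ?A i)" by (simp add: bij_betw_same_card)
  then show ?thesis by simp
qed

section \<open>Subtrees of a spider\<close>

text \<open>
  If \<open>g k\<close> is the colour of the edge number \<open>k\<close> of a leg, counted from the centre and from \<open>0\<close>,
  this is the contribution to the discrepancy in colour \<open>j\<close> of the \<open>t\<close> edges nearest to the centre.
\<close>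

definition excess :: "nat \<Rightarrow> (nat \<Rightarrow> nat) \<Rightarrow> nat \<Rightarrow> nat \<Rightarrow> int" where
  "excess r g j t = int r * int (card {k. k < t \<and> g k = j}) - int t"

text \<open>
  Edges are represented by their endpoint farther from the centre, so that counting edges
  becomes counting numbers.
\<close>

lemma discrepancy_by_vertices:
  fixes l :: nat
  assumes "1 \<le> l" "W \<subseteq> {1..}" "E = (\<lambda>v. {v, v - l}) ` W"
  shows "card E = card W" "card (f -` {j} \<inter> E) = card {v \<in> W. f {v, v - l} = j}"
proof -
  let ?e = "\<lambda>v. {v, v - l}"
  have inj: "inj_on ?e W" by (rule inj_on_subset[OF inj_on_spider_edge]) (use assms in auto)
  then show "card E = card W" using assms by (simp add: card_image)
  have "f -` {j} \<inter> E = ?e ` {v \<in> W. f (?e v) = j}" using assms by auto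
  moreover have "inj_on ?e {v \<in> W. f (?e v) = j}" by (rule inj_on_subset[OF inj]) auto
  ultimately show "card (f -` {j} \<inter> E) = card {v \<in> W. f {v, v - l} = j}"
    by (simp add: card_image)
qed

lemma discrepancy_by_legs:
  assumes l: "1 \<le> l" and W: "W \<subseteq> {1..l * n}" and E: "E = (\<lambda>v. {v, v - l}) ` W"
    and t: "\<And>i. i < l \<Longrightarrow> {k. k < n \<and> k * l + i + 1 \<in> W} = {..<t i}"
    and g: "\<And>i k. i < l \<Longrightarrow> k < n \<Longrightarrow> f {k * l + i + 1, k * l + i + 1 - l} = g i k"
  shows "int r * int (card (f -` {j} \<inter> E)) - int (card E) = (\<Sum>i<l. excess r (g i) j (t i))"
proof -
  let ?Wj = "{v \<in> W. f {v, v - l} = j}"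
  have "card W = (\<Sum>i<l. t i)"
    using card_by_legs[OF W] t by simp
  moreover have "card ?Wj = (\<Sum>i<l. card {k. k < t i \<and> g i k = j})"
  proof -
    have "{k. k < n \<and> k * l + i + 1 \<in> ?Wj} = {k. k < t i \<and> g i k = j}" if "i < l" for i
    proof -
      have k: "k < t i \<longleftrightarrow> k < n \<and> k * l + i + 1 \<in> W" for k using t[OF that] by blast
      have "f {k * l + i + 1, k * l + i + 1 - l} = j \<longleftrightarrow> g i k = j" if "k < n" for k
        using g[OF \<open>i < l\<close> that] by simp
      then show ?thesis unfolding k by blast
    qed
    moreover have "card ?Wj = (\<Sum>i<l. card {k. k < n \<and> k * l + i + 1 \<in> ?Wj})"
      by (rule card_by_legs) (use W in auto)
    ultimately show ?thesis by simp
  qed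
  moreover have "W \<subseteq> {1..}" using W by auto
  ultimately show ?thesis
    using discrepancy_by_vertices(1)[OF l _ E] discrepancy_by_vertices(2)[OF l _ E, of f j]
    by (simp add: excess_def sum_subtractf sum_distrib_left)
qed

text \<open>
  The centre together with initial segments of the legs, of arbitrarily prescribed lengths, is
  closed under taking parents and hence a subtree.  The lengths can thus be optimised leg by leg.
\<close>

lemma prefix_subtree:
  assumes l: "1 \<le> l" and t: "\<And>i. i < l \<Longrightarrow> t i \<le> n"
    and g: "\<And>i k. i < l \<Longrightarrow> k < n \<Longrightarrow> f {k * l + i + 1, k * l + i + 1 - l} = g i k"
  obtains S where "S \<in> subtrees (spider l n)"
    "int r * int (card (f -` {j} \<inter> edges S)) - int (card (edges S)) =
       (\<Sum>i<l. excess r (g i) j (t i))"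
proof -
  define W where "W = {v \<in> {1..l * n}. (v - 1) div l < t ((v - 1) mod l)}"
  let ?S = "parent_graph (\<lambda>v. v - l) (insert 0 W)"
  have "insert 0 W - {0} = W" by (auto simp: W_def)
  then have E: "edges ?S = (\<lambda>v. {v, v - l}) ` W" by (simp add: parent_graph_def)
  have "is_tree ?S"
  proof (rule is_tree_parent_graph)
    fix v assume v: "v \<in> insert 0 W" "v \<noteq> 0"
    have "v - l \<in> W" if "l < v"
    proof -
      have "(v - 1) div l = Suc ((v - l - 1) div l)" "(v - 1) mod l = (v - l - 1) mod l"
        using le_div_geq[of l "v - 1"] le_mod_geq[of l "v - 1"] that l by (auto simp: diff_commute)
      with v that show ?thesis by (auto simp: W_def)
    qed
    with v l show "v - l \<in> insert 0 W \<and> v - l < v" by (cases "l < v") auto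
  qed (auto simp: W_def)
  moreover have "verts ?S \<subseteq> {0..l * n}" by (auto simp: parent_graph_def W_def)
  moreover have "edges ?S \<subseteq> edges (spider l n)" unfolding E edges_spider by (auto simp: W_def)
  ultimately have "?S \<in> subtrees (spider l n)" by (simp add: subtrees_def)
  moreover have "{k. k < n \<and> k * l + i + 1 \<in> W} = {..<t i}" if "i < l" for i
  proof -
    have "k * l + i + 1 \<in> W \<longleftrightarrow> k < t i" if "k < n" for k
      using leg_vertex_in_range[OF \<open>i < l\<close> that] \<open>i < l\<close> by (simp add: W_def)
    with t[OF that] show ?thesis by auto
  qed
  moreover have "W \<subseteq> {1..l * n}" by (auto simp: W_def)
  ultimately show thesis
    using discrepancy_by_legs[where W = W and t = t and g = g and j = j, OF l _ E _ g] that
    by blast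
qed

lemma down_closed_eq_lessThan:
  fixes A :: "nat set"
  assumes "finite A" "\<And>k. Suc k \<in> A \<Longrightarrow> k \<in> A"
  obtains t where "A = {..<t}"
proof
  let ?t = "LEAST t. t \<notin> A"
  have ex: "\<exists>t. t \<notin> A" using assms(1) ex_new_if_finite infinite_UNIV_nat by blast
  have down: "a \<in> A" if "b \<in> A" "a \<le> b" for a b
    using that(2,1) by (induction rule: dec_induct) (use assms(2) in auto)
  show "A = {..<?t}"
  proof (intro equalityI subsetI)
    show "k \<in> {..<?t}" if "k \<in> A" for k
      using LeastI_ex[OF ex] down[OF that, of ?t] by (meson lessThan_iff not_less)
    show "k \<in> A" if "k \<in> {..<?t}" for k
      using not_less_Least[of k "\<lambda>t. t \<notin> A"] that by blast
  qed
qed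

text \<open>
  The two alternatives are whether the subtree contains the centre or not.  Removing an edge of
  the spider separates the centre from the outer part of the leg, so a subtree containing the
  centre contains with every edge all edges between it and the centre.  A connected set of
  vertices that avoids the centre cannot change from one leg to another.
\<close>

lemma subtree_spider_cases:
  assumes l: "1 \<le> l" and S: "S \<in> subtrees (spider l n)"
  obtains W where "W \<subseteq> {1..l * n}" "edges S = (\<lambda>v. {v, v - l}) ` W"
    "(\<forall>v\<in>W. l < v \<longrightarrow> v - l \<in> W) \<or> (\<exists>i. \<forall>v\<in>W. (v - 1) mod l = i)"
proof -
  define W where "W = {v \<in> {1..l * n}. {v, v - l} \<in> edges S}"
  have sub: "edges S \<subseteq> edges (spider l n)" and sg: "simple_graph S" and con: "graph_connected S"
    using S by (auto simp: subtrees_def is_tree_def)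
  have E: "edges S = (\<lambda>v. {v, v - l}) ` W" using sub by (auto simp: W_def edges_spider)
  have inS: "v \<in> verts S" "v - l \<in> verts S" if "v \<in> W" for v
  proof -
    from that have "{v, v - l} \<in> edges S" by (simp add: W_def)
    with sg obtain a b where "a \<in> verts S" "b \<in> verts S" "{v, v - l} = {a, b}"
      unfolding simple_graph_def by blast
    then have "{v, v - l} \<subseteq> verts S" by simp
    then show "v \<in> verts S" "v - l \<in> verts S" by auto
  qed
  have adjS: "(x \<in> W \<and> y = x - l) \<or> (y \<in> W \<and> x = y - l)" if "adj S x y" for x y
    using that by (auto simp: adj_def E doubleton_eq_iff)
  show thesis
  proof (cases "0 \<in> verts S")
    case True
    have "v - l \<in> W" if v: "v \<in> W" "l < v" for v
    proof (rule ccontr)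
      assume no: "v - l \<notin> W"
      \<comment> \<open>If the edge from \<open>v - l\<close> to its parent is absent, the vertices beyond it form a set closed
        under adjacency, which would have to contain the centre.\<close>
      have "\<exists>k. 0 = v - l + k * l"
      proof (rule connected_invariant[where P = "\<lambda>x. \<exists>k. x = v - l + k * l", OF con])
        show "v - l \<in> verts S" using inS v by simp
        show "\<exists>k. v - l = v - l + k * l" by (rule exI[of _ 0]) simp
        fix x y assume "adj S x y" "\<exists>k. x = v - l + k * l"
        then obtain k where k: "x = v - l + k * l" by blast
        from adjS[OF \<open>adj S x y\<close>] show "\<exists>k. y = v - l + k * l"
        proof
          assume a: "x \<in> W \<and> y = x - l"
          with k no obtain k' where "k = Suc k'" by (cases k) auto
          with a k show ?thesis by (intro exI[of _ k']) simp
        next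
          assume a: "y \<in> W \<and> x = y - l"
          with k v have "y = v - l + Suc k * l" by simp
          then show ?thesis by blast
        qed
      qed (rule True)
      with v show False by simp
    qed
    with E show thesis by (intro that[of W]) (auto simp: W_def)
  next
    case False
    obtain m where m: "m \<in> verts S" using con by (auto simp: graph_connected_def)
    have "(w - 1) mod l = (m - 1) mod l" if w: "w \<in> verts S" for w
    proof (rule connected_invariant[where P = "\<lambda>x. (x - 1) mod l = (m - 1) mod l", OF con m w])
      fix x y assume a: "adj S x y" and x: "(x - 1) mod l = (m - 1) mod l"
      have "(z - 1) mod l = (z - l - 1) mod l" if "z \<in> W" for z
      proof -
        have "l < z" using inS[OF that] False by (metis diff_is_0_eq not_less)
        then show ?thesis using le_mod_geq[of l "z - 1"] by (simp add: diff_commute)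
      qed
      with adjS[OF a] x show "(y - 1) mod l = (m - 1) mod l" by auto
    qed simp
    with E inS show thesis by (intro that[of W]) (auto simp: W_def)
  qed
qed

section \<open>The lower bound\<close>

lemma sum_distinct_nats_ge:
  assumes "finite (A :: nat set)"
  shows "card A * (card A - 1) \<le> 2 * \<Sum>A"
  using assms
proof (induction "card A" arbitrary: A)
  case (Suc c)
  let ?m = "Max A"
  have "A \<noteq> {}" using Suc.hyps(2) by auto
  then have m: "?m \<in> A" using Suc.prems by simp
  have "card A \<le> card {..?m}" using Suc.prems by (intro card_mono) auto
  then have "c \<le> ?m" using Suc.hyps(2) by simp
  moreover have "c * (c - 1) \<le> 2 * \<Sum>(A - {?m})"
  proof -
    have "card (A - {?m}) = c" using Suc.hyps(2) m by simp
    with Suc.hyps(1)[of "A - {?m}"] Suc.prems show ?thesis by simp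
  qed
  moreover have "\<Sum>A = ?m + \<Sum>(A - {?m})" using m Suc.prems by (simp add: sum.remove)
  moreover have "Suc c * c = 2 * c + c * (c - 1)" by (cases c) auto
  ultimately show ?case using Suc.hyps(2)[symmetric] by simp
qed simp

text \<open>The differences \<open>M - v t\<close> are distinct natural numbers.\<close>

lemma sum_distinct_bounded_le:
  fixes v :: "nat \<Rightarrow> int"
  assumes "inj_on v {..<r}" "\<And>t. t < r \<Longrightarrow> v t \<le> M"
  shows "2 * (\<Sum>t<r. v t) \<le> int r * (2 * M - (int r - 1))"
proof -
  let ?d = "\<lambda>t. nat (M - v t)"
  have inj: "inj_on ?d {..<r}"
  proof (rule inj_onI)
    fix t u assume "t \<in> {..<r}" "u \<in> {..<r}" "?d t = ?d u"
    with assms(2)[of t] assms(2)[of u] have "v t = v u" by simp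
    with assms(1) \<open>t \<in> {..<r}\<close> \<open>u \<in> {..<r}\<close> show "t = u" by (auto dest: inj_onD)
  qed
  have "r * (r - 1) \<le> 2 * \<Sum>(?d ` {..<r})"
    using sum_distinct_nats_ge[of "?d ` {..<r}"] by (simp add: card_image[OF inj])
  also have "\<Sum>(?d ` {..<r}) = (\<Sum>t<r. ?d t)" by (simp add: sum.reindex[OF inj])
  finally have "int (r * (r - 1)) \<le> 2 * int (\<Sum>t<r. ?d t)" by linarith
  also have "int (\<Sum>t<r. ?d t) = (\<Sum>t<r. M - v t)"
    using assms(2) by simp
  also have "\<dots> = int r * M - (\<Sum>t<r. v t)" by (simp add: sum_subtractf)
  finally show ?thesis by (cases r) (auto simp: algebra_simps)
qed

text \<open>The excess of \<open>t\<close> edges is congruent to \<open>- t\<close> modulo \<open>r\<close>.\<close>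

lemma inj_on_excess: "inj_on (excess r g j) {..<r}"
proof (rule inj_onI)
  fix t u assume t: "t \<in> {..<r}" "u \<in> {..<r}" and eq: "excess r g j t = excess r g j u"
  have "(- excess r g j x) mod int r = int x" if "x < r" for x
  proof -
    have "- excess r g j x = int x + int r * (- int (card {k. k < x \<and> g k = j}))"
      by (simp add: excess_def)
    then show ?thesis using that by (simp only: mod_mult_self2) simp
  qed
  with t eq have "int t = int u" by (metis lessThan_iff)
  then show "t = u" by simp
qed

text \<open>Each edge contributes \<open>card C - 1\<close> for its own colour and \<open>- 1\<close> for each other colour.\<close>

lemma sum_excess_colours:
  assumes "finite C" "\<And>k. k < t \<Longrightarrow> g k \<in> C"
  shows "(\<Sum>j\<in>C. excess (card C) g j t) = 0"
proof -
  have "(\<Sum>j\<in>C. card {k \<in> {..<t}. g k = j}) = card {..<t}"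
    using sum.group[of "{..<t}" C g "\<lambda>_. 1::nat"] assms by auto
  then have "(\<Sum>j\<in>C. int (card {k. k < t \<and> g k = j})) = int t"
    by (simp flip: of_nat_sum)
  then show ?thesis by (simp add: excess_def sum_subtractf flip: sum_distrib_left)
qed

text \<open>
  With \<open>t j\<close> chosen to maximise the excess in colour \<open>j\<close>, double counting of the excesses over all
  colours and all lengths below \<open>r\<close> proves the claim: the total is \<open>0\<close>, while for each colour the
  \<open>r\<close> distinct values stay at or below the maximum.
\<close>

lemma leg_lower_bound:
  assumes "finite C" "card C = r" "1 \<le> r" "\<And>k. k < r - 1 \<Longrightarrow> g k \<in> C"
  obtains t where "\<And>j. t j \<le> r - 1"
    "int r * (int r - 1) \<le> 2 * (\<Sum>j\<in>C. excess r g j (t j))"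
proof -
  have "\<exists>t. t \<le> r - 1 \<and> (\<forall>u<r. excess r g j u \<le> excess r g j t)" for j
  proof -
    have ne: "finite (excess r g j ` {..<r})" "excess r g j ` {..<r} \<noteq> {}"
      using assms(3) by (auto simp: lessThan_empty_iff)
    from Max_in[OF ne] obtain t where "t < r" "Max (excess r g j ` {..<r}) = excess r g j t"
      by auto
    with Max_ge[OF ne(1)] show ?thesis by (intro exI[of _ t]) auto
  qed
  then obtain t where t: "\<And>j. t j \<le> r - 1"
    and mx: "\<And>j u. u < r \<Longrightarrow> excess r g j u \<le> excess r g j (t j)"
    by metis
  have "0 = 2 * (\<Sum>u<r. \<Sum>j\<in>C. excess r g j u)"
    using sum_excess_colours[of C _ g] assms by simp
  also have "\<dots> = (\<Sum>j\<in>C. 2 * (\<Sum>u<r. excess r g j u))"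
    by (subst sum.swap) (simp add: sum_distrib_left)
  also have "\<dots> \<le> (\<Sum>j\<in>C. int r * (2 * excess r g j (t j) - (int r - 1)))"
    by (intro sum_mono sum_distinct_bounded_le inj_on_excess mx)
  also have "\<dots> = int r * (2 * (\<Sum>j\<in>C. excess r g j (t j)) - int r * (int r - 1))"
    using assms(2) by (simp add: sum_subtractf flip: sum_distrib_left)
  finally have "int r * (int r - 1) \<le> 2 * (\<Sum>j\<in>C. excess r g j (t j))"
    using assms(3) by (simp add: zero_le_mult_iff)
  with t that show thesis by blast
qed

text \<open>Some colour attains at least the average over the colours of the sum of the leg maxima.\<close>

lemma spider_lower_bound:
  assumes r: "1 \<le> r" and l: "1 \<le> l" and f: "f \<in> edges (spider l (r - 1)) \<rightarrow> {1..r}"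
  obtains S j where "S \<in> subtrees (spider l (r - 1))" "j \<in> {1..r}"
    "int l * (int r - 1) \<le> 2 * (int r * int (card (f -` {j} \<inter> edges S)) - int (card (edges S)))"
proof -
  define g where "g i k = f {k * l + i + 1, k * l + i + 1 - l}" for i k
  have gC: "g i k \<in> {1..r}" if "i < l" "k < r - 1" for i k
  proof -
    from leg_vertex_in_range[OF that]
    have "{k * l + i + 1, k * l + i + 1 - l} \<in> edges (spider l (r - 1))"
      unfolding edges_spider by blast
    with f show ?thesis by (auto simp: g_def)
  qed
  have "\<exists>t. (\<forall>j. t j \<le> r - 1) \<and>
      int r * (int r - 1) \<le> 2 * (\<Sum>j\<in>{1..r}. excess r (g i) j (t j))" if "i < l" for i
    by (rule leg_lower_bound[of "{1..r}" r "g i"]) (use gC[OF that] r in auto)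
  then obtain t where t: "\<And>i j. i < l \<Longrightarrow> t i j \<le> r - 1"
    and big: "\<And>i. i < l \<Longrightarrow> int r * (int r - 1) \<le> 2 * (\<Sum>j\<in>{1..r}. excess r (g i) j (t i j))"
    by metis
  have "\<exists>j\<in>{1..r}. int l * (int r - 1) \<le> 2 * (\<Sum>i<l. excess r (g i) j (t i j))"
  proof (rule ccontr)
    assume "\<not> ?thesis"
    then have "(\<Sum>j\<in>{1..r}. 2 * (\<Sum>i<l. excess r (g i) j (t i j))) <
        (\<Sum>j\<in>{1..r}. int l * (int r - 1))"
      using r by (intro sum_strict_mono) (auto simp: not_le)
    moreover have "(\<Sum>j\<in>{1..r}. 2 * (\<Sum>i<l. excess r (g i) j (t i j))) =
        (\<Sum>i<l. 2 * (\<Sum>j\<in>{1..r}. excess r (g i) j (t i j)))"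
      by (simp only: sum_distrib_left[symmetric]) (subst sum.swap, rule refl)
    moreover have "(\<Sum>i<l. int r * (int r - 1)) \<le>
        (\<Sum>i<l. 2 * (\<Sum>j\<in>{1..r}. excess r (g i) j (t i j)))"
      by (intro sum_mono big) simp
    ultimately show False by (simp add: mult.left_commute)
  qed
  then obtain j where j: "j \<in> {1..r}"
    "int l * (int r - 1) \<le> 2 * (\<Sum>i<l. excess r (g i) j (t i j))" by blast
  obtain S where "S \<in> subtrees (spider l (r - 1))"
    "int r * int (card (f -` {j} \<inter> edges S)) - int (card (edges S)) =
       (\<Sum>i<l. excess r (g i) j (t i j))"
    by (rule prefix_subtree[where t = "\<lambda>i. t i j" and g = g and r = r and j = j and f = f,
        OF l t g_def[symmetric]])
  with j that show thesis by auto
qed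

section \<open>The upper bound\<close>

text \<open>
  In terms of \<open>x = j - 1\<close>, the first ranking is \<open>x\<close> itself and the second is its cyclic shift by
  \<open>r div 2\<close>.  If \<open>r\<close> is odd, the sums \<open>a j + b j\<close> are \<open>r\<close> consecutive integers, so a third ranking
  makes the total constant.  If \<open>r\<close> is even, the sums take every second value of an interval,
  each exactly twice; the third ranking gives two consecutive ranks to the two colours that share
  a sum, and the totals differ by at most one.
\<close>

lemma balanced_triple:
  obtains a b c :: "nat \<Rightarrow> nat" where
    "bij_betw a {1..r} {..<r}" "bij_betw b {1..r} {..<r}" "bij_betw c {1..r} {..<r}"
    "\<And>j. j \<in> {1..r} \<Longrightarrow> 2 * (a j + b j + c j) \<le> 3 * (r - 1) + 1"
proof -
  define m where "m = r div 2"
  define q where "q = r mod 2"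
  have r: "r = 2 * m + q" and q: "q = 0 \<or> q = 1" by (auto simp: m_def q_def)
  define b where "b j = (if j \<le> m + q then j - 1 + m else j - 1 - (m + q))" for j
  define c where "c j = (if j \<le> m + q then r + 1 - 2 * j else 2 * (r - j) + q)" for j
  have bij: "bij_betw h {1..r} {..<r}"
    if "\<And>x y. \<lbrakk>1 \<le> x; x < y; y \<le> r\<rbrakk> \<Longrightarrow> h x \<noteq> h y" "\<And>x. \<lbrakk>1 \<le> x; x \<le> r\<rbrakk> \<Longrightarrow> h x < r"
    for h :: "nat \<Rightarrow> nat"
  proof -
    have "inj_on h {1..r}"
      using that(1) by (intro linorder_inj_onI) auto
    moreover have "h ` {1..r} \<subseteq> {..<r}" using that(2) by auto
    ultimately show ?thesis by (simp add: bij_betw_def card_image card_subset_eq)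
  qed
  show thesis
  proof (rule that[of "\<lambda>j. j - 1" b c])
    show "bij_betw (\<lambda>j. j - 1) {1..r} {..<r}" by (rule bij) auto
    show "bij_betw b {1..r} {..<r}"
      by (rule bij; use r q in \<open>simp add: b_def; linarith\<close>)
    show "bij_betw c {1..r} {..<r}"
    proof (rule bij)
      fix x y assume xy: "1 \<le> x" "x < y" "y \<le> r"
      \<comment> \<open>Both branches of \<open>c\<close> are strictly decreasing, and they take values of different parity.\<close>
      have "even (c x) \<noteq> even (c y)" if "x \<le> m + q" "m + q < y"
        using that r q xy by (elim disjE) (auto simp: c_def)
      moreover have "c x \<noteq> c y" if "y \<le> m + q"
        using that xy r q unfolding c_def by simp linarith
      moreover have "c x \<noteq> c y" if "m + q < x"
        using that xy unfolding c_def by simp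
      ultimately show "c x \<noteq> c y" by (metis not_less)
    qed (use r q in \<open>simp add: c_def; linarith\<close>)
    show "2 * (j - 1 + b j + c j) \<le> 3 * (r - 1) + 1" if "j \<in> {1..r}" for j
      using that r q by (auto simp: b_def c_def)
  qed
qed

text \<open>
  Adding a ranking and its reverse raises every sum by \<open>r - 1\<close> and preserves the bound, so only
  \<open>l = 0\<close> and \<open>l = 3\<close> need a direct argument.  A single ranking attains the value \<open>r - 1\<close>, which is
  too large once \<open>r\<close> exceeds 2; this is why \<open>l = 1\<close> is excluded.
\<close>

lemma balanced_rankings:
  assumes "l \<noteq> 1"
  shows "\<exists>s :: nat \<Rightarrow> nat \<Rightarrow> nat. (\<forall>i<l. bij_betw (s i) {1..r} {..<r}) \<and>
    (\<forall>j\<in>{1..r}. 2 * (\<Sum>i<l. s i j) \<le> l * (r - 1) + 1)"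
  using assms
proof (induction l rule: less_induct)
  case (less l)
  consider "l = 0" | "l = 3" | l' where "l = l' + 2" "l' \<noteq> 1"
    using less.prems by (metis One_nat_def add_2_eq_Suc' not0_implies_Suc
      numeral_3_eq_3)
  then show ?case
  proof cases
    case 1
    then show ?thesis by simp
  next
    case 2
    obtain a b c where abc: "bij_betw a {1..r} {..<r}" "bij_betw b {1..r} {..<r}"
      "bij_betw c {1..r} {..<r}" "\<And>j. j \<in> {1..r} \<Longrightarrow> 2 * (a j + b j + c j) \<le> 3 * (r - 1) + 1"
      using balanced_triple[of r] by blast
    show ?thesis
      unfolding 2
      by (rule exI[of _ "\<lambda>i. if i = 0 then a else if i = 1 then b else c"])
        (use abc in \<open>auto simp: numeral_3_eq_3\<close>)
  next
    case 3
    then obtain s where s: "\<forall>i<l'. bij_betw (s i) {1..r} {..<r}"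
      "\<forall>j\<in>{1..r}. 2 * (\<Sum>i<l'. s i j) \<le> l' * (r - 1) + 1"
      using less.IH[of l'] by auto
    define s' where
      "s' i = (if i < l' then s i else if i = l' then (\<lambda>j. j - 1) else (\<lambda>j. r - j))" for i
    have "bij_betw (\<lambda>j. j - 1) {1..r} {..<r}"
      by (rule bij_betwI[where g = Suc]) auto
    moreover have "bij_betw (\<lambda>j. r - j) {1..r} {..<r}"
      by (rule bij_betwI[where g = "\<lambda>k. r - k"]) auto
    ultimately have "\<forall>i<l. bij_betw (s' i) {1..r} {..<r}"
      using s 3 by (auto simp: s'_def)
    moreover have "2 * (\<Sum>i<l. s' i j) \<le> l * (r - 1) + 1" if j: "j \<in> {1..r}" for j
    proof -
      have "(\<Sum>i<l. s' i j) = (\<Sum>i<l'. s i j) + (r - 1)"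
        using j 3 by (auto simp: s'_def)
      moreover have "2 * (\<Sum>i<l'. s i j) \<le> l' * (r - 1) + 1" using s j by blast
      moreover have "l * (r - 1) = l' * (r - 1) + 2 * (r - 1)"
        unfolding 3 by (rule add_mult_distrib)
      ultimately show ?thesis by linarith
    qed
    ultimately show ?thesis by blast
  qed
qed

text \<open>
  The colours in decreasing order of \<open>s\<close>, from the centre outwards.  On a leg of length \<open>r - 1\<close> the
  colour with \<open>s\<close>-value \<open>0\<close> does not occur.
\<close>

definition leg_colouring :: "nat \<Rightarrow> (nat \<Rightarrow> nat) \<Rightarrow> nat \<Rightarrow> nat" where
  "leg_colouring r s k = inv_into {1..r} s (r - 1 - k)"

lemma leg_colouring:
  assumes "bij_betw s {1..r} {..<r}" "k < r"
  shows "leg_colouring r s k \<in> {1..r}" "s (leg_colouring r s k) = r - 1 - k"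
proof -
  have "r - 1 - k \<in> s ` {1..r}" using assms by (auto simp: bij_betw_def)
  then show "leg_colouring r s k \<in> {1..r}" "s (leg_colouring r s k) = r - 1 - k"
    unfolding leg_colouring_def by (rule inv_into_into, rule f_inv_into_f)
qed

text \<open>
  A colour gains \<open>r\<close> at its single occurrence, which comes after \<open>r - 1 - s j\<close> other edges; the
  excess right after that occurrence is \<open>s j\<close>, and it only decreases later.
\<close>

lemma excess_leg_colouring_le:
  assumes "bij_betw s {1..r} {..<r}" "t \<le> r"
  shows "excess r (leg_colouring r s) j t \<le> int (s j)"
proof (cases "\<exists>k<t. leg_colouring r s k = j")
  case True
  then obtain k where k: "k < t" "leg_colouring r s k = j" by blast
  have "k' = k" if "k' < t" "leg_colouring r s k' = j" for k'
    using leg_colouring(2)[OF assms(1), of k] leg_colouring(2)[OF assms(1), of k'] k that assms(2)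
    by simp
  with k have "{k. k < t \<and> leg_colouring r s k = j} = {k}" by blast
  moreover have "s j = r - 1 - k" using leg_colouring(2)[OF assms(1), of k] k assms(2) by simp
  ultimately show ?thesis using k assms(2) by (simp add: excess_def)
next
  case False
  then have none: "{k. k < t \<and> leg_colouring r s k = j} = {}" by blast
  show ?thesis unfolding excess_def none by simp
qed

lemma spider_upper_bound:
  assumes r: "1 \<le> r" and l: "2 \<le> l"
  obtains f where "f \<in> edges (spider l (r - 1)) \<rightarrow>\<^sub>E {1..r}"
    "\<And>S j. S \<in> subtrees (spider l (r - 1)) \<Longrightarrow> j \<in> {1..r} \<Longrightarrow>
      2 * (int r * int (card (f -` {j} \<inter> edges S)) - int (card (edges S))) \<le> int l * (int r - 1) + 1"
proof -
  let ?n = "r - 1"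
  obtain s where s: "\<And>i. i < l \<Longrightarrow> bij_betw (s i) {1..r} {..<r}"
    and bal: "\<And>j. j \<in> {1..r} \<Longrightarrow> 2 * (\<Sum>i<l. s i j) \<le> l * (r - 1) + 1"
    using balanced_rankings[of l r] l by force
  define g where "g i = leg_colouring r (s i)" for i
  define h where "h v = g ((v - 1) mod l) ((v - 1) div l)" for v
  define f where "f = restrict (\<lambda>e. h (Max e)) (edges (spider l ?n))"
  have leg: "(v - 1) mod l < l" "(v - 1) div l < ?n" if "v \<in> {1..l * ?n}" for v
  proof -
    show "(v - 1) mod l < l" using l by simp
    have "v - 1 < ?n * l" using that by (auto simp: mult.commute)
    then show "(v - 1) div l < ?n" by (rule less_mult_imp_div_less)
  qed
  have fh: "f {v, v - l} = h v" if "v \<in> {1..l * ?n}" for v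
  proof -
    have "Max {v, v - l} = v" by simp
    with that show ?thesis unfolding f_def edges_spider by simp
  qed
  have fC: "f \<in> edges (spider l ?n) \<rightarrow>\<^sub>E {1..r}"
  proof (rule PiE_I)
    fix e assume "e \<in> edges (spider l ?n)"
    then obtain v where "v \<in> {1..l * ?n}" "e = {v, v - l}" unfolding edges_spider by blast
    with fh leg[of v] leg_colouring(1)[OF s] show "f e \<in> {1..r}" by (simp add: h_def g_def)
  qed (simp add: f_def)
  have "2 * (int r * int (card (f -` {j} \<inter> edges S)) - int (card (edges S)))
      \<le> int l * (int r - 1) + 1"
    if S: "S \<in> subtrees (spider l ?n)" and j: "j \<in> {1..r}" for S j
  proof -
    have l1: "1 \<le> l" using l by simp
    obtain W where W: "W \<subseteq> {1..l * ?n}" and E: "edges S = (\<lambda>v. {v, v - l}) ` W"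
      and alt: "(\<forall>v\<in>W. l < v \<longrightarrow> v - l \<in> W) \<or> (\<exists>i. \<forall>v\<in>W. (v - 1) mod l = i)"
      using subtree_spider_cases[OF l1 S] by blast
    from alt show ?thesis
    proof
      assume closed: "\<forall>v\<in>W. l < v \<longrightarrow> v - l \<in> W"
      have "\<exists>t. {k. k < ?n \<and> k * l + i + 1 \<in> W} = {..<t}" for i
      proof -
        have down: "k * l + i + 1 \<in> W" if "Suc k * l + i + 1 \<in> W" for k
          using closed[rule_format, OF that] by simp
        obtain t where "{k. k < ?n \<and> k * l + i + 1 \<in> W} = {..<t}"
        proof (rule down_closed_eq_lessThan)
          fix k assume "Suc k \<in> {k. k < ?n \<and> k * l + i + 1 \<in> W}"
          with down[of k] show "k \<in> {k. k < ?n \<and> k * l + i + 1 \<in> W}" by simp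
        qed simp
        then show ?thesis by blast
      qed
      then obtain t where t: "\<And>i. {k. k < ?n \<and> k * l + i + 1 \<in> W} = {..<t i}" by metis
      have tn: "t i \<le> ?n" for i
      proof -
        have "{..<t i} \<subseteq> {..<?n}" unfolding t[symmetric] by auto
        then show ?thesis by simp
      qed
      have "f {k * l + i + 1, k * l + i + 1 - l} = g i k" if "i < l" "k < ?n" for i k
        using fh[OF leg_vertex_in_range[OF that]] that by (simp add: h_def)
      then have "int r * int (card (f -` {j} \<inter> edges S)) - int (card (edges S)) =
          (\<Sum>i<l. excess r (g i) j (t i))"
        by (intro discrepancy_by_legs[OF l1 W E t])
      also have "\<dots> \<le> (\<Sum>i<l. int (s i j))"
        unfolding g_def
        by (intro sum_mono excess_leg_colouring_le s) (auto intro: le_trans[OF tn])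
      also have "\<dots> = int (\<Sum>i<l. s i j)" by simp
      finally have "2 * (int r * int (card (f -` {j} \<inter> edges S)) - int (card (edges S)))
          \<le> int (2 * (\<Sum>i<l. s i j))" by simp
      also have "\<dots> \<le> int (l * (r - 1) + 1)" using bal[OF j] by (simp only: of_nat_le_iff)
      also have "\<dots> = int l * (int r - 1) + 1" using r by (simp add: of_nat_diff)
      finally show ?thesis .
    next
      assume "\<exists>i. \<forall>v\<in>W. (v - 1) mod l = i"
      \<comment> \<open>All edges lie on leg \<open>i\<close>, so at most one of them has colour \<open>j\<close>.\<close>
      then obtain i where i: "\<And>v. v \<in> W \<Longrightarrow> (v - 1) mod l = i" by blast
      let ?Wj = "{v \<in> W. f {v, v - l} = j}"
      have finW: "finite W" using W finite_subset by blast
      have "v = w" if "v \<in> ?Wj" "w \<in> ?Wj" for v w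
      proof -
        have vw: "v \<in> {1..l * ?n}" "w \<in> {1..l * ?n}" using that W by auto
        have il: "i < l" using i[of v] leg(1)[OF vw(1)] that by simp
        have "h v = h w" using fh[OF vw(1)] fh[OF vw(2)] that by simp
        moreover have "(v - 1) mod l = i" "(w - 1) mod l = i" using i that by blast+
        ultimately have "g i ((v - 1) div l) = g i ((w - 1) div l)" by (simp only: h_def)
        then have "r - 1 - (v - 1) div l = r - 1 - (w - 1) div l"
          using leg_colouring(2)[OF s[OF il]] leg(2)[OF vw(1)] leg(2)[OF vw(2)]
          by (metis g_def diff_le_self less_le_trans)
        then have "(v - 1) div l = (w - 1) div l"
          using leg(2)[OF vw(1)] leg(2)[OF vw(2)] by linarith
        moreover have "(v - 1) mod l = (w - 1) mod l" using i that by simp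
        ultimately have "v - 1 = w - 1" by (metis div_mult_mod_eq)
        with vw show ?thesis by auto
      qed
      then have "\<forall>v\<in>?Wj. \<forall>w\<in>?Wj. v = w" by blast
      moreover have "finite ?Wj" using finW by simp
      ultimately have "card ?Wj \<le> 1" by (simp only: One_nat_def card_le_Suc0_iff_eq)
      moreover have "card ?Wj \<le> card W" using finW by (intro card_mono) auto
      ultimately have "card ?Wj = 0 \<or> card ?Wj = 1 \<and> 1 \<le> card W" by linarith
      moreover have W1: "W \<subseteq> {1..}" using W by auto
      ultimately have "int r * int (card (f -` {j} \<inter> edges S)) - int (card (edges S)) \<le> int r - 1"
        unfolding discrepancy_by_vertices(1)[OF l1 W1 E]
          discrepancy_by_vertices(2)[OF l1 W1 E, of f j]
        using r by auto
      then have "2 * (int r * int (card (f -` {j} \<inter> edges S)) - int (card (edges S)))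
          \<le> 2 * (int r - 1)" by simp
      also have "\<dots> \<le> int l * (int r - 1)"
        using l r by (intro mult_right_mono) auto
      also have "\<dots> \<le> int l * (int r - 1) + 1" by simp
      finally show ?thesis .
    qed
  qed
  with fC that show thesis by blast
qed

section \<open>The discrepancy of the spider\<close>

lemma tree_discrepancy_eqI:
  assumes T: "is_tree T" and r: "1 \<le> r"
    and lower: "\<And>f. f \<in> edges T \<rightarrow>\<^sub>E {1..r} \<Longrightarrow> \<exists>S\<in>subtrees T. \<exists>j\<in>{1..r}.
      D \<le> int r * int (card (f -` {j} \<inter> edges S)) - int (card (edges S))"
    and upper: "f \<in> edges T \<rightarrow>\<^sub>E {1..r}" "\<And>S j. S \<in> subtrees T \<Longrightarrow> j \<in> {1..r} \<Longrightarrow>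
      int r * int (card (f -` {j} \<inter> edges S)) - int (card (edges S)) \<le> D"
  shows "tree_discrepancy r T = D"
proof -
  let ?d = "\<lambda>f S j. int r * int (card (f -` {j} \<inter> edges S)) - int (card (edges S))"
  let ?M = "\<lambda>f. MAX S\<in>subtrees T. MAX j\<in>{1..r}. ?d f S j"
  have fin: "finite (subtrees T)" "finite (edges T \<rightarrow>\<^sub>E {1..r})"
    using T finite_subtrees[of T] finite_colourings[of T r] by (simp_all add: is_tree_def)
  have ne: "subtrees T \<noteq> {}" "{1..r} \<noteq> {}" "(edges T \<rightarrow>\<^sub>E {1..r}) \<noteq> {}"
    using subtrees_nonempty[OF T] r upper(1) by auto
  have "D \<le> ?M f" if "f \<in> edges T \<rightarrow>\<^sub>E {1..r}" for f
    using lower[OF that] fin ne by (simp add: Max_ge_iff)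
  moreover have "?M f \<le> D" using upper(2) fin ne by (simp add: Max_le_iff)
  ultimately show ?thesis
    unfolding tree_discrepancy_def using fin ne upper(1)
    by (intro antisym) (auto simp: Min_le_iff Min_ge_iff intro!: bexI[of _ f])
qed

theorem proposition10:
  fixes r l :: nat
  assumes "r \<ge> 2" and "l \<ge> 2"
  shows "\<exists>T :: nat graph. is_tree T \<and> card (leaves T) = l \<and>
           tree_discrepancy r T = \<lceil>(real r - 1) * (real l / 2)\<rceil>"
proof -
  let ?T = "spider l (r - 1)" and ?D = "\<lceil>(real r - 1) * (real l / 2)\<rceil>"
  \<comment> \<open>The ceiling of \<open>X / 2\<close> is the only integer \<open>d\<close> with \<open>X \<le> 2 * d \<le> X + 1\<close>.\<close>
  let ?X = "int l * (int r - 1)"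
  have "(real r - 1) * (real l / 2) = real_of_int ?X / 2" by simp
  then have D: "?X \<le> 2 * d \<Longrightarrow> ?D \<le> d" "2 * d \<le> ?X + 1 \<Longrightarrow> d \<le> ?D" for d
    by linarith+
  have r: "1 \<le> r" and l: "1 \<le> l" using assms by auto
  have "is_tree ?T" using is_tree_spider l by blast
  moreover have "card (leaves ?T) = l" using card_leaves_spider assms by simp
  moreover have "tree_discrepancy r ?T = ?D"
  proof -
    obtain f where f: "f \<in> edges ?T \<rightarrow>\<^sub>E {1..r}"
      "\<And>S j. S \<in> subtrees ?T \<Longrightarrow> j \<in> {1..r} \<Longrightarrow>
        2 * (int r * int (card (f -` {j} \<inter> edges S)) - int (card (edges S))) \<le> ?X + 1"
      using spider_upper_bound[OF r assms(2)] by blast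
    show ?thesis
    proof (rule tree_discrepancy_eqI[OF \<open>is_tree ?T\<close> r _ f(1)])
      fix f' assume "f' \<in> edges ?T \<rightarrow>\<^sub>E {1..r}"
      then have "f' \<in> edges ?T \<rightarrow> {1..r}" by auto
      from spider_lower_bound[OF r l this] D(1)
      show "\<exists>S\<in>subtrees ?T. \<exists>j\<in>{1..r}.
          ?D \<le> int r * int (card (f' -` {j} \<inter> edges S)) - int (card (edges S))"
        by metis
    qed (use f(2) D(2) in blast)
  qed
  ultimately show ?thesis by blast
qed

end
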